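(* Let $r\ge 2$ be an integer, and let $E$ and $\widetilde{E}$ be fibrewise homotopy equivalent fibrewise spaces over $B$. Then $\mathrm{TC}_{B,r}(E)=\mathrm{TC}_{B,r}(\widetilde{E})$.
   Context: All spaces are topological spaces, all maps are continuous, $I=[0,1]$. A fibrewise space over $B$ is a space $X$ with a map $p_X\colon X\to B$; a fibrewise map $f\colon X\to Y$ satisfies $p_Y\circ f=p_X$. Subspaces of $X$ are fibrewise spaces by restricting $p_X$. Two fibrewise maps $f,g\colon X\to Y$ are fibrewise homotopic, $f\simeq_B g$, if there is $H\colon X\times I\to Y$ with $p_Y(H(x,t))=p_X(x)$, $H(x,0)=f(x)$, $H(x,1)=g(x)$; fibrewise homotopy equivalence is defined accordingly. For a fibrewise map $f\colon E\to X$ over $B$, $\mathrm{secat}_B(f)$ is the least $k\ge 0$ (or $\infty$) such that $X$ has an open cover $\{U_0,\dots,U_k\}$ where for each $i$ there is a fibrewise map $s_i\colon U_i\to E$ with $f\circ s_i\simeq_B i_{U_i}$, $i_{U_i}\colon U_i\hookrightarrow X$ the inclusion. For a fibrewise space $E$ over $B$, $P_B(E)=\{(b,\alpha)\in B\times E^I\mid p_E\circ\alpha \text{ is constant at } b\}$ (with $E^I$ in the compact-open topology), with projection $(b,\alpha)\mapsto b$. $E_B^r$ is the $r$-fold fibred product of $E$ over $B$. Define $\Pi_{r,E}\colon P_B(E)\to E_B^r$, $\Pi_{r,E}(b,\gamma)=(\gamma(0),\gamma(\tfrac1{r-1}),\dots,\gamma(\tfrac{r-2}{r-1}),\gamma(1))$.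 The sequential parametrized topological complexity is $\mathrm{TC}_{B,r}(E):=\mathrm{secat}_B(\Pi_{r,E})$. *)

theory Defs
  imports "HOL-Analysis.Analysis" "HOL-Library.Extended_Nat"
begin

text \<open>
  A fibrewise space over \<open>B\<close> is given by an abstract topology \<open>X\<close> together with its projection
  \<open>p\<close>; only the values of \<open>p\<close> on \<open>topspace X\<close> matter.
\<close>

definition fibrewise_space :: "'b topology \<Rightarrow> 'a topology \<Rightarrow> ('a \<Rightarrow> 'b) \<Rightarrow> bool" where
  "fibrewise_space B X p \<longleftrightarrow> continuous_map X B p"

definition over_base :: "'a topology \<Rightarrow> ('a \<Rightarrow> 'b) \<Rightarrow> ('c \<Rightarrow> 'b) \<Rightarrow> ('a \<Rightarrow> 'c) \<Rightarrow> bool" where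
  "over_base X p q f \<longleftrightarrow> (\<forall>x\<in>topspace X. q (f x) = p x)"

definition fibrewise_map ::
    "'a topology \<Rightarrow> ('a \<Rightarrow> 'b) \<Rightarrow> 'c topology \<Rightarrow> ('c \<Rightarrow> 'b) \<Rightarrow> ('a \<Rightarrow> 'c) \<Rightarrow> bool" where
  "fibrewise_map X p Y q f \<longleftrightarrow> continuous_map X Y f \<and> over_base X p q f"

text \<open>
  \<^const>\<open>homotopic_with\<close> imposes its side condition on every stage of the homotopy, that is,
  \<open>q (h (t, x)) = p x\<close> for all \<open>t\<close> in the unit interval.
\<close>

definition fibrewise_homotopic ::
    "'a topology \<Rightarrow> ('a \<Rightarrow> 'b) \<Rightarrow> 'c topology \<Rightarrow> ('c \<Rightarrow> 'b) \<Rightarrow> ('a \<Rightarrow> 'c) \<Rightarrow> ('a \<Rightarrow> 'c) \<Rightarrow> bool" where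
  "fibrewise_homotopic X p Y q f g \<longleftrightarrow> homotopic_with (over_base X p q) X Y f g"

definition fibrewise_homotopy_equivalent ::
    "'a topology \<Rightarrow> ('a \<Rightarrow> 'b) \<Rightarrow> 'c topology \<Rightarrow> ('c \<Rightarrow> 'b) \<Rightarrow> bool" where
  "fibrewise_homotopy_equivalent X p Y q \<longleftrightarrow>
     (\<exists>f g. fibrewise_map X p Y q f \<and> fibrewise_map Y q X p g \<and>
        fibrewise_homotopic X p X p (g \<circ> f) id \<and>
        fibrewise_homotopic Y q Y q (f \<circ> g) id)"

text \<open>
  \<open>secat E pE X pX f\<close> is meant for fibrewise maps \<open>f\<close> from \<open>E\<close> to \<open>X\<close>. The infimum of the empty
  set in \<^typ>\<open>enat\<close> is \<open>\<infinity>\<close>.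
\<close>

definition secat ::
    "'a topology \<Rightarrow> ('a \<Rightarrow> 'b) \<Rightarrow> 'c topology \<Rightarrow> ('c \<Rightarrow> 'b) \<Rightarrow> ('a \<Rightarrow> 'c) \<Rightarrow> enat" where
  "secat E pE X pX f = Inf {enat k |k. \<exists>U :: nat \<Rightarrow> 'c set.
     (\<forall>i\<le>k. openin X (U i)) \<and> (\<Union>i\<le>k. U i) = topspace X \<and>
     (\<forall>i\<le>k. \<exists>s. fibrewise_map (subtopology X (U i)) pX E pE s \<and>
        fibrewise_homotopic (subtopology X (U i)) pX X pX (f \<circ> s) id)}"

text \<open>
  Points of the mapping space are functions that are \<^const>\<open>undefined\<close> outside \<open>topspace X\<close>, so
  that each continuous map is represented exactly once. The compact-open topology has the sets of
  maps carrying a compact \<open>K\<close> into an open \<open>U\<close> as a subbasis.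
\<close>

definition mapping_carrier :: "'a topology \<Rightarrow> 'c topology \<Rightarrow> ('a \<Rightarrow> 'c) set" where
  "mapping_carrier X Y = {g \<in> extensional (topspace X). continuous_map X Y g}"

definition compact_open_topology :: "'a topology \<Rightarrow> 'c topology \<Rightarrow> ('a \<Rightarrow> 'c) topology" where
  "compact_open_topology X Y =
     topology_generated_by
       {{g \<in> mapping_carrier X Y. g ` K \<subseteq> U} |K U. compactin X K \<and> openin Y U}"

lemma topspace_compact_open_topology:
  "topspace (compact_open_topology X Y) = mapping_carrier X Y"
proof -
  have "mapping_carrier X Y \<in>
      {{g \<in> mapping_carrier X Y. g ` K \<subseteq> U} |K U. compactin X K \<and> openin Y U}"
    by (rule CollectI, rule exI[of _ "{}"], rule exI[of _ "{}"]) auto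
  then show ?thesis
    unfolding compact_open_topology_def topology_generated_by_topspace by blast
qed

abbreviation unit_interval :: "real topology" where
  "unit_interval \<equiv> top_of_set {0..1}"

definition fibrewise_path_space ::
    "'b topology \<Rightarrow> 'a topology \<Rightarrow> ('a \<Rightarrow> 'b) \<Rightarrow> ('b \<times> (real \<Rightarrow> 'a)) topology" where
  "fibrewise_path_space B E p =
     subtopology (prod_topology B (compact_open_topology unit_interval E))
       {(b, \<alpha>). \<forall>t\<in>{0..1}. p (\<alpha> t) = b}"

text \<open>
  The coordinates of the \<open>r\<close>-fold fibred product are indexed by \<open>0, \<dots>, r - 1\<close>; its projection to
  the base, below, uses the coordinate \<open>0\<close> and hence needs \<open>r \<ge> 1\<close>.
\<close>

definition fibred_power :: "nat \<Rightarrow> 'a topology \<Rightarrow> ('a \<Rightarrow> 'b) \<Rightarrow> (nat \<Rightarrow> 'a) topology" where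
  "fibred_power r E p =
     subtopology (product_topology (\<lambda>_. E) {..<r}) {x. \<forall>i<r. \<forall>j<r. p (x i) = p (x j)}"

definition fibred_power_proj :: "('a \<Rightarrow> 'b) \<Rightarrow> (nat \<Rightarrow> 'a) \<Rightarrow> 'b" where
  "fibred_power_proj p x = p (x 0)"

definition path_evaluation :: "nat \<Rightarrow> 'b \<times> (real \<Rightarrow> 'a) \<Rightarrow> (nat \<Rightarrow> 'a)" where
  "path_evaluation r = (\<lambda>(b, \<gamma>). \<lambda>i\<in>{..<r}. \<gamma> (real i / real (r - 1)))"

definition param_TC :: "'b topology \<Rightarrow> nat \<Rightarrow> 'a topology \<Rightarrow> ('a \<Rightarrow> 'b) \<Rightarrow> enat" where
  "param_TC B r E p =
     secat (fibrewise_path_space B E p) fst (fibred_power r E p) (fibred_power_proj p)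
       (path_evaluation r)"

lemma fibrewise_map_path_evaluation:
  assumes "r \<ge> 2"
  shows "fibrewise_map (fibrewise_path_space B E p) fst (fibred_power r E p)
           (fibred_power_proj p) (path_evaluation r)"
proof -
  let ?C = "compact_open_topology unit_interval E"
  have I: "real i / real (r - 1) \<in> {0..1}" if "i < r" for i
    using that by (cases r) (auto simp: divide_le_eq_1)
  have ev: "continuous_map ?C E (\<lambda>\<gamma>. \<gamma> t)" if t: "t \<in> {0..1}" for t
    unfolding continuous_map_def
  proof (intro conjI allI impI)
    show "(\<lambda>\<gamma>. \<gamma> t) \<in> topspace ?C \<rightarrow> topspace E"
      using t by (auto simp: topspace_compact_open_topology mapping_carrier_def continuous_map_def)
    fix U assume U: "openin E U"
    have "compactin unit_interval {t}" using t by simp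
    moreover have "{\<gamma> \<in> topspace ?C. \<gamma> t \<in> U} = {g \<in> mapping_carrier unit_interval E. g ` {t} \<subseteq> U}"
      by (auto simp: topspace_compact_open_topology)
    ultimately have "{\<gamma> \<in> topspace ?C. \<gamma> t \<in> U} \<in> {{g \<in> mapping_carrier unit_interval E. g ` K \<subseteq> V} |K V.
        compactin unit_interval K \<and> openin E V}"
      using U by blast
    then show "openin ?C {\<gamma> \<in> topspace ?C. \<gamma> t \<in> U}"
      unfolding compact_open_topology_def by (rule topology_generated_by_Basis)
  qed
  have cont: "continuous_map (fibrewise_path_space B E p) E
      (\<lambda>z. snd z (real i / real (r - 1)))" if "i < r" for i
    unfolding fibrewise_path_space_def
    using continuous_map_compose[OF continuous_map_snd ev[OF I[OF that]]]
    by (intro continuous_map_from_subtopology) (simp add: o_def)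
  have P: "p (snd z t) = fst z"
    if "z \<in> topspace (fibrewise_path_space B E p)" "t \<in> {0..1}" for z t
    using that by (auto simp: fibrewise_path_space_def topspace_subtopology)
  have "continuous_map (fibrewise_path_space B E p) (product_topology (\<lambda>_. E) {..<r})
      (path_evaluation r)"
    unfolding continuous_map_componentwise
    using cont by (auto simp: path_evaluation_def case_prod_unfold)
  moreover have "p (path_evaluation r z i) = fst z"
    if "z \<in> topspace (fibrewise_path_space B E p)" "i < r" for z i
    using P[OF that(1) I[OF that(2)]] that(2)
    by (simp add: path_evaluation_def case_prod_unfold)
  ultimately show ?thesis
    using assms
    by (auto simp: fibrewise_map_def fibred_power_def over_base_def fibred_power_proj_def
        continuous_map_in_subtopology)
qed

end

theory Submission
  imports Defs
begin

text \<open>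
  Parametrized topological complexity does not increase along fibrewise domination: if
  \<open>f : E \<rightarrow> E'\<close> and \<open>g : E' \<rightarrow> E\<close> are fibrewise maps with \<open>f \<circ> g \<simeq> id\<close> over the base, then
  \<open>param_TC B r E' p' \<le> param_TC B r E p\<close>. A fibrewise homotopy equivalence gives domination in
  both directions, hence equality.

  For the inequality, pull an open set \<open>U\<close> of the fibred power of \<open>E\<close> with a local homotopy
  section \<open>s\<close> back along the power \<open>g\<^sup>r\<close>, and push the section forward along post-composition of
  paths with \<open>f\<close>. Evaluating paths commutes with post-composition, so the new section
  \<open>f \<circ> s \<circ> g\<^sup>r\<close> evaluates to \<open>f\<^sup>r \<circ> ev \<circ> s \<circ> g\<^sup>r \<simeq> f\<^sup>r \<circ> g\<^sup>r \<simeq> id\<close>. The argument rests on the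
  commuting square and the right homotopy inverse alone, so it is given for arbitrary fibrewise
  maps (\<open>secat_le_of_dominated\<close>). What is specific to path spaces is that post-composition is
  continuous for the compact-open topology, and that a fibrewise homotopy applied in every
  coordinate preserves the fibred power.
\<close>

section \<open>Fibrewise maps and fibrewise homotopies\<close>

lemma continuous_map_into_topspace:
  assumes "continuous_map X Y f" and "x \<in> topspace X"
  shows "f x \<in> topspace Y"
  using assms by (auto simp: continuous_map_def)

lemma fibrewise_map_compose:
  assumes "fibrewise_map X p Y q f" and "fibrewise_map Y q Z r g"
  shows "fibrewise_map X p Z r (g \<circ> f)"
  using assms continuous_map_compose[of X Y f Z g]
  by (auto simp: fibrewise_map_def over_base_def dest: continuous_map_into_topspace)

lemma fibrewise_map_from_subtopology:
  assumes "fibrewise_map X p Y q f"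
  shows "fibrewise_map (subtopology X S) p Y q f"
  using assms by (auto simp: fibrewise_map_def over_base_def continuous_map_from_subtopology)

lemma fibrewise_map_into_subtopology:
  assumes "fibrewise_map X p Y q f" and "\<And>x. x \<in> topspace X \<Longrightarrow> f x \<in> S"
  shows "fibrewise_map X p (subtopology Y S) q f"
  using assms by (auto simp: fibrewise_map_def continuous_map_in_subtopology)

lemma fibrewise_homotopic_trans:
  assumes "fibrewise_homotopic X p Y q f g" and "fibrewise_homotopic X p Y q g h"
  shows "fibrewise_homotopic X p Y q f h"
  using assms unfolding fibrewise_homotopic_def by (rule homotopic_with_trans)

lemma fibrewise_homotopic_cong:
  assumes "fibrewise_homotopic X p Y q f g"
    and "\<And>x. x \<in> topspace X \<Longrightarrow> f' x = f x" and "\<And>x. x \<in> topspace X \<Longrightarrow> g' x = g x"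
  shows "fibrewise_homotopic X p Y q f' g'"
  using assms(1) unfolding fibrewise_homotopic_def
  by (rule homotopic_with_eq) (use assms(2,3) in \<open>auto simp: over_base_def\<close>)

text \<open>
  The side condition \<^const>\<open>over_base\<close> alone does not keep the stages of a homotopy inside
  \<open>topspace Y\<close>, which is where \<open>k\<close> is known to respect the projections. The continuity of the
  stages, which every homotopy has, is therefore first added to the side condition.
\<close>

lemma fibrewise_homotopic_compose_left:
  assumes "fibrewise_homotopic X p Y q f g" and k: "fibrewise_map Y q Z r k"
  shows "fibrewise_homotopic X p Z r (k \<circ> f) (k \<circ> g)"
proof -
  have "homotopic_with (\<lambda>j. continuous_map X Y j \<and> over_base X p q j) X Y f g"
    using assms(1) unfolding fibrewise_homotopic_def by (rule homotopic_with_mono) auto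
  then show ?thesis
    unfolding fibrewise_homotopic_def
    by (rule homotopic_with_compose_continuous_map_left)
      (use k in \<open>auto simp: fibrewise_map_def over_base_def dest: continuous_map_into_topspace\<close>)
qed

lemma fibrewise_homotopic_compose_right:
  assumes "fibrewise_homotopic Y q Z r f g" and k: "fibrewise_map X p Y q k"
  shows "fibrewise_homotopic X p Z r (f \<circ> k) (g \<circ> k)"
  using assms(1) unfolding fibrewise_homotopic_def
  by (rule homotopic_with_compose_continuous_map_right)
    (use k in \<open>auto simp: fibrewise_map_def over_base_def dest: continuous_map_into_topspace\<close>)

section \<open>Sectional category under domination\<close>

text \<open>
  The square formed by \<open>\<phi>\<close>, \<open>F\<close> and the maps \<open>e\<close>, \<open>e'\<close> turns a local homotopy section \<open>s\<close> of
  \<open>e\<close> over \<open>U\<close> into the local homotopy section \<open>\<phi> \<circ> s \<circ> G\<close> of \<open>e'\<close> over the preimage of \<open>U\<close>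
  under \<open>G\<close>, since \<open>e' \<circ> \<phi> \<circ> s \<circ> G = F \<circ> e \<circ> s \<circ> G \<simeq> F \<circ> G \<simeq> id\<close> there. Covers pull back to
  covers of the same size.
\<close>

lemma secat_le_of_dominated:
  assumes \<phi>: "fibrewise_map E pE E' pE' \<phi>"
    and F: "fibrewise_map X pX X' pX' F"
    and G: "fibrewise_map X' pX' X pX G"
    and square: "\<And>z. z \<in> topspace E \<Longrightarrow> e' (\<phi> z) = F (e z)"
    and FG: "fibrewise_homotopic X' pX' X' pX' (F \<circ> G) id"
  shows "secat E' pE' X' pX' e' \<le> secat E pE X pX e"
  unfolding secat_def
proof (rule Inf_superset_mono, rule subsetI, elim CollectE exE conjE)
  fix n k and U :: "nat \<Rightarrow> _ set"
  assume n: "n = enat k" and U_open: "\<forall>i\<le>k. openin X (U i)"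
    and U_cover: "(\<Union>i\<le>k. U i) = topspace X"
    and sections: "\<forall>i\<le>k. \<exists>s. fibrewise_map (subtopology X (U i)) pX E pE s \<and>
        fibrewise_homotopic (subtopology X (U i)) pX X pX (e \<circ> s) id"
  define V where "V i = {x \<in> topspace X'. G x \<in> U i}" for i
  have G_cont: "continuous_map X' X G"
    using G by (simp add: fibrewise_map_def)
  have "\<forall>i\<le>k. openin X' (V i)"
    using U_open openin_continuous_map_preimage[OF G_cont] by (auto simp: V_def)
  moreover have "(\<Union>i\<le>k. V i) = topspace X'"
    using U_cover continuous_map_funspace[OF G_cont] by (auto simp: V_def)
  moreover have "\<exists>s. fibrewise_map (subtopology X' (V i)) pX' E' pE' s \<and>
        fibrewise_homotopic (subtopology X' (V i)) pX' X' pX' (e' \<circ> s) id" if i: "i \<le> k" for i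
  proof -
    let ?U = "subtopology X (U i)" and ?V = "subtopology X' (V i)"
    obtain s where s: "fibrewise_map ?U pX E pE s"
      and es: "fibrewise_homotopic ?U pX X pX (e \<circ> s) id"
      using sections i by blast
    have GV: "fibrewise_map ?V pX' ?U pX G"
      by (intro fibrewise_map_into_subtopology fibrewise_map_from_subtopology G)
        (auto simp: V_def)
    have FesG: "fibrewise_homotopic ?V pX' X' pX' (F \<circ> ((e \<circ> s) \<circ> G)) (F \<circ> (id \<circ> G))"
      by (rule fibrewise_homotopic_compose_left
          [OF fibrewise_homotopic_compose_right[OF es GV] F])
    have "e' (\<phi> (s (G x))) = F (e (s (G x)))" if "x \<in> topspace ?V" for x
    proof (rule square)
      have "fibrewise_map ?V pX' E pE (s \<circ> G)"
        by (rule fibrewise_map_compose[OF GV s])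
      then show "s (G x) \<in> topspace E"
        using that by (auto simp: fibrewise_map_def dest: continuous_map_into_topspace)
    qed
    then have "fibrewise_homotopic ?V pX' X' pX' (e' \<circ> (\<phi> \<circ> (s \<circ> G))) (F \<circ> G)"
      by (intro fibrewise_homotopic_cong[OF FesG]) simp_all
    moreover have "fibrewise_homotopic ?V pX' X' pX' (F \<circ> G) id"
    proof -
      have "fibrewise_map ?V pX' X' pX' id"
        by (rule fibrewise_map_from_subtopology) (simp add: fibrewise_map_def over_base_def)
      from fibrewise_homotopic_compose_right[OF FG this] show ?thesis
        by simp
    qed
    ultimately have "fibrewise_homotopic ?V pX' X' pX' (e' \<circ> (\<phi> \<circ> (s \<circ> G))) id"
      by (rule fibrewise_homotopic_trans)
    moreover have "fibrewise_map ?V pX' E' pE' (\<phi> \<circ> (s \<circ> G))"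
      by (intro fibrewise_map_compose[OF _ \<phi>] fibrewise_map_compose[OF GV s])
    ultimately show ?thesis
      by blast
  qed
  ultimately show "n \<in> {enat k |k. \<exists>U :: nat \<Rightarrow> _ set.
     (\<forall>i\<le>k. openin X' (U i)) \<and> (\<Union>i\<le>k. U i) = topspace X' \<and>
     (\<forall>i\<le>k. \<exists>s. fibrewise_map (subtopology X' (U i)) pX' E' pE' s \<and>
        fibrewise_homotopic (subtopology X' (U i)) pX' X' pX' (e' \<circ> s) id)}"
    using n by blast
qed

section \<open>Fibred powers and path spaces as functors\<close>

definition power_map :: "nat \<Rightarrow> ('a \<Rightarrow> 'c) \<Rightarrow> (nat \<Rightarrow> 'a) \<Rightarrow> (nat \<Rightarrow> 'c)" where
  "power_map r f x = (\<lambda>i\<in>{..<r}. f (x i))"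

lemma topspace_fibred_power:
  "topspace (fibred_power r E p) =
     {x \<in> {..<r} \<rightarrow>\<^sub>E topspace E. \<forall>i<r. \<forall>j<r. p (x i) = p (x j)}"
  unfolding fibred_power_def topspace_subtopology topspace_product_topology by blast

lemma fibred_power_component_in:
  assumes "x \<in> topspace (fibred_power r E p)" and "i < r"
  shows "x i \<in> topspace E"
  using assms unfolding topspace_fibred_power by blast

lemma fibred_power_same_fibre:
  assumes "x \<in> topspace (fibred_power r E p)" and "i < r" and "j < r"
  shows "p (x i) = p (x j)"
  using assms unfolding topspace_fibred_power by blast

lemma fibred_power_extensional:
  assumes "x \<in> topspace (fibred_power r E p)"
  shows "x \<in> extensional {..<r}"
  using assms unfolding topspace_fibred_power by (simp add: PiE_def)

lemma continuous_map_fibred_power_component: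
  assumes "i < r"
  shows "continuous_map (fibred_power r E p) E (\<lambda>x. x i)"
  unfolding fibred_power_def
  using assms by (intro continuous_map_from_subtopology continuous_map_product_projection) simp

lemma continuous_map_into_fibred_power:
  assumes "\<And>i. i < r \<Longrightarrow> continuous_map X E (\<lambda>x. h x i)"
    and "\<And>x. x \<in> topspace X \<Longrightarrow> h x \<in> extensional {..<r}"
    and "\<And>x i j. \<lbrakk>x \<in> topspace X; i < r; j < r\<rbrakk> \<Longrightarrow> p (h x i) = p (h x j)"
  shows "continuous_map X (fibred_power r E p) h"
proof -
  have "continuous_map X (product_topology (\<lambda>_. E) {..<r}) h"
    using assms(1,2) by (auto simp: continuous_map_componentwise)
  moreover have "h ` topspace X \<subseteq> {x. \<forall>i<r. \<forall>j<r. p (x i) = p (x j)}"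
    using assms(3) by blast
  ultimately show ?thesis
    by (simp add: fibred_power_def continuous_map_in_subtopology image_subset_iff_funcset)
qed

lemma fibrewise_map_power_map:
  assumes "0 < r" and f: "fibrewise_map E p E' p' f"
  shows "fibrewise_map (fibred_power r E p) (fibred_power_proj p)
           (fibred_power r E' p') (fibred_power_proj p') (power_map r f)"
proof -
  have proj: "p' (f (x i)) = p (x i)" if "x \<in> topspace (fibred_power r E p)" "i < r" for x i
    using f fibred_power_component_in[OF that] by (simp add: fibrewise_map_def over_base_def)
  have "continuous_map (fibred_power r E p) (fibred_power r E' p') (power_map r f)"
  proof (rule continuous_map_into_fibred_power)
    fix i assume "i < r"
    then show "continuous_map (fibred_power r E p) E' (\<lambda>x. power_map r f x i)"
      using continuous_map_compose[OF continuous_map_fibred_power_component] f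
      by (auto simp: power_map_def fibrewise_map_def o_def)
  next
    fix x i j assume "x \<in> topspace (fibred_power r E p)" "i < r" "j < r"
    then show "p' (power_map r f x i) = p' (power_map r f x j)"
      using fibred_power_same_fibre[of x r E p i j] by (simp add: power_map_def proj)
  qed (simp add: power_map_def)
  then show ?thesis
    using assms(1) proj
    by (auto simp: fibrewise_map_def over_base_def fibred_power_proj_def power_map_def)
qed

text \<open>
  Every stage of a fibrewise homotopy moves a point within its fibre, so applying it
  simultaneously in all coordinates keeps the coordinates in a common fibre.
\<close>

lemma fibrewise_homotopic_power_map:
  assumes "0 < r" and "fibrewise_homotopic E p E' p' f g"
  shows "fibrewise_homotopic (fibred_power r E p) (fibred_power_proj p)
           (fibred_power r E' p') (fibred_power_proj p') (power_map r f) (power_map r g)"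
proof -
  let ?X = "fibred_power r E p" and ?X' = "fibred_power r E' p'"
  obtain h where h: "continuous_map (prod_topology unit_interval E) E' h"
    and h0: "\<And>x. h (0, x) = f x" and h1: "\<And>x. h (1, x) = g x"
    and h_base: "\<And>t. t \<in> {0..1} \<Longrightarrow> over_base E p p' (\<lambda>x. h (t, x))"
    using assms(2) unfolding fibrewise_homotopic_def homotopic_with_def by blast
  define H where "H = (\<lambda>(t, x). power_map r (\<lambda>y. h (t, y)) x)"
  have proj: "p' (h (t, x i)) = p (x i)"
    if "t \<in> {0..1}" "x \<in> topspace ?X" "i < r" for t x i
    using h_base[OF that(1)] fibred_power_component_in[OF that(2,3)] by (simp add: over_base_def)
  have "continuous_map (prod_topology unit_interval ?X) ?X' H"
  proof (rule continuous_map_into_fibred_power)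
    fix i assume i: "i < r"
    have "continuous_map (prod_topology unit_interval ?X) (prod_topology unit_interval E)
        (\<lambda>z. (fst z, snd z i))"
      using continuous_map_compose[OF continuous_map_snd
          continuous_map_fibred_power_component[OF i], of unit_interval E p]
      by (intro continuous_map_pairedI continuous_map_fst) (simp add: o_def)
    from continuous_map_compose[OF this h] i
    show "continuous_map (prod_topology unit_interval ?X) E' (\<lambda>z. H z i)"
      by (simp add: H_def power_map_def o_def case_prod_unfold)
  next
    fix z i j assume "z \<in> topspace (prod_topology unit_interval ?X)" "i < r" "j < r"
    then show "p' (H z i) = p' (H z j)"
      using fibred_power_same_fibre[of "snd z" r E p i j]
      by (auto simp: H_def power_map_def proj)
  qed (auto simp: H_def power_map_def)
  moreover have "over_base ?X (fibred_power_proj p) (fibred_power_proj p') (\<lambda>x. H (t, x))"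
    if "t \<in> {0..1}" for t
    using assms(1) that by (auto simp: over_base_def fibred_power_proj_def H_def power_map_def proj)
  ultimately show ?thesis
    unfolding fibrewise_homotopic_def homotopic_with_def
    by (intro exI[of _ H]) (auto simp: H_def h0 h1)
qed

text \<open>
  The result is cut off outside \<open>{0..1}\<close> because points of the mapping space are extensional.
\<close>

definition path_map :: "('a \<Rightarrow> 'c) \<Rightarrow> 'b \<times> (real \<Rightarrow> 'a) \<Rightarrow> 'b \<times> (real \<Rightarrow> 'c)" where
  "path_map f = (\<lambda>(b, \<alpha>). (b, \<lambda>t\<in>{0..1}. f (\<alpha> t)))"

text \<open>
  A path \<open>f \<circ> \<alpha>\<close> carries \<open>K\<close> into \<open>U\<close> exactly if \<open>\<alpha>\<close> carries \<open>K\<close> into the preimage of \<open>U\<close>, so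
  preimages of subbasic sets are subbasic.
\<close>

lemma continuous_map_compact_open_postcompose:
  assumes f: "continuous_map Y Z f"
  shows "continuous_map (compact_open_topology X Y) (compact_open_topology X Z)
           (\<lambda>\<alpha>. restrict (f \<circ> \<alpha>) (topspace X))"
  (is "continuous_map _ _ ?post")
proof -
  have carrier: "?post \<alpha> \<in> mapping_carrier X Z" if "\<alpha> \<in> mapping_carrier X Y" for \<alpha>
  proof -
    have "continuous_map X Z (f \<circ> \<alpha>)"
      using that f by (auto simp: mapping_carrier_def intro: continuous_map_compose)
    then have "continuous_map X Z (?post \<alpha>)"
      by (rule continuous_map_eq) simp
    then show ?thesis
      by (simp add: mapping_carrier_def)
  qed
  show ?thesis
    unfolding compact_open_topology_def[of X Z]
  proof (rule continuous_on_generated_topo)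
    fix W assume "W \<in> {{g \<in> mapping_carrier X Z. g ` K \<subseteq> U} |K U. compactin X K \<and> openin Z U}"
    then obtain K U where W: "W = {g \<in> mapping_carrier X Z. g ` K \<subseteq> U}"
      and K: "compactin X K" and U: "openin Z U"
      by blast
    let ?U' = "{y \<in> topspace Y. f y \<in> U}"
    have K_sub: "K \<subseteq> topspace X"
      using K by (rule compactin_subset_topspace)
    have "?post -` W \<inter> mapping_carrier X Y = {g \<in> mapping_carrier X Y. g ` K \<subseteq> ?U'}"
    proof (rule set_eqI)
      fix \<alpha>
      have "?post \<alpha> ` K \<subseteq> U \<longleftrightarrow> \<alpha> ` K \<subseteq> ?U'" if "\<alpha> \<in> mapping_carrier X Y"
      proof -
        have "\<alpha> x \<in> topspace Y" "?post \<alpha> x = f (\<alpha> x)" if "x \<in> K" for x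
          using \<open>\<alpha> \<in> mapping_carrier X Y\<close> K_sub that
          by (auto simp: mapping_carrier_def dest: continuous_map_into_topspace)
        then show ?thesis
          unfolding image_subset_iff by simp
      qed
      then show "\<alpha> \<in> ?post -` W \<inter> mapping_carrier X Y \<longleftrightarrow>
          \<alpha> \<in> {g \<in> mapping_carrier X Y. g ` K \<subseteq> ?U'}"
        using carrier unfolding W by blast
    qed
    moreover have "openin (compact_open_topology X Y) {g \<in> mapping_carrier X Y. g ` K \<subseteq> ?U'}"
      unfolding compact_open_topology_def
      by (rule topology_generated_by_Basis)
        (use K openin_continuous_map_preimage[OF f U] in blast)
    ultimately show "openin (compact_open_topology X Y)
        (?post -` W \<inter> topspace (compact_open_topology X Y))"
      by (simp add: topspace_compact_open_topology)
  next
    show "?post ` topspace (compact_open_topology X Y) \<subseteq>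
        \<Union>{{g \<in> mapping_carrier X Z. g ` K \<subseteq> U} |K U. compactin X K \<and> openin Z U}"
      using carrier topspace_compact_open_topology[of X Z]
      unfolding compact_open_topology_def[of X Z] topology_generated_by_topspace
      by (auto simp: topspace_compact_open_topology)
  qed
qed

lemma topspace_fibrewise_path_space:
  "topspace (fibrewise_path_space B E p) =
     {(b, \<alpha>). b \<in> topspace B \<and> \<alpha> \<in> mapping_carrier unit_interval E \<and> (\<forall>t\<in>{0..1}. p (\<alpha> t) = b)}"
  by (auto simp: fibrewise_path_space_def topspace_compact_open_topology)

lemma path_in_topspace:
  assumes "\<alpha> \<in> mapping_carrier unit_interval E" and "t \<in> {0..1}"
  shows "\<alpha> t \<in> topspace E"
  using assms by (auto simp: mapping_carrier_def dest: continuous_map_into_topspace)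

lemma fibrewise_map_path_map:
  assumes f: "fibrewise_map E p E' p' f"
  shows "fibrewise_map (fibrewise_path_space B E p) fst (fibrewise_path_space B E' p') fst
           (path_map f)"
proof -
  let ?P = "fibrewise_path_space B E p"
  have "continuous_map (compact_open_topology unit_interval E)
      (compact_open_topology unit_interval E') (\<lambda>\<alpha>. \<lambda>t\<in>{0..1}. f (\<alpha> t))"
    using continuous_map_compact_open_postcompose[of E E' f unit_interval] f
    by (simp add: fibrewise_map_def o_def)
  from continuous_map_compose[OF continuous_map_snd this]
  have "continuous_map ?P (prod_topology B (compact_open_topology unit_interval E')) (path_map f)"
    unfolding fibrewise_path_space_def path_map_def case_prod_unfold
    by (intro continuous_map_from_subtopology continuous_map_pairedI continuous_map_fst)
      (simp add: o_def)
  moreover have "p' (f (\<alpha> t)) = b" if "(b, \<alpha>) \<in> topspace ?P" "t \<in> {0..1}" for b \<alpha> t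
    using f that path_in_topspace[of \<alpha> E t]
    by (auto simp: topspace_fibrewise_path_space fibrewise_map_def over_base_def)
  ultimately show ?thesis
    by (auto simp: fibrewise_map_def over_base_def path_map_def
        fibrewise_path_space_def[of B E'] continuous_map_in_subtopology)
qed

lemma path_evaluation_path_map:
  "path_evaluation r (path_map f z) = power_map r f (path_evaluation r z)"
proof -
  have "real i / real (r - 1) \<in> {0..1}" if "i < r" for i
    using that by (cases r) (auto simp: divide_le_eq_1)
  then show ?thesis
    by (auto simp: path_evaluation_def path_map_def power_map_def case_prod_unfold
        intro!: restrict_ext)
qed

section \<open>Homotopy invariance\<close>

lemma param_TC_le_of_dominated:
  assumes "0 < r"
    and f: "fibrewise_map E p E' p' f" and g: "fibrewise_map E' p' E p g"
    and fg: "fibrewise_homotopic E' p' E' p' (f \<circ> g) id"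
  shows "param_TC B r E' p' \<le> param_TC B r E p"
  unfolding param_TC_def
proof (rule secat_le_of_dominated)
  show "fibrewise_map (fibrewise_path_space B E p) fst (fibrewise_path_space B E' p') fst
      (path_map f)"
    by (rule fibrewise_map_path_map[OF f])
  show "fibrewise_map (fibred_power r E p) (fibred_power_proj p)
      (fibred_power r E' p') (fibred_power_proj p') (power_map r f)"
    by (rule fibrewise_map_power_map[OF assms(1) f])
  show "fibrewise_map (fibred_power r E' p') (fibred_power_proj p')
      (fibred_power r E p) (fibred_power_proj p) (power_map r g)"
    by (rule fibrewise_map_power_map[OF assms(1) g])
  show "path_evaluation r (path_map f z) = power_map r f (path_evaluation r z)" for z
    by (rule path_evaluation_path_map)
  show "fibrewise_homotopic (fibred_power r E' p') (fibred_power_proj p')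
      (fibred_power r E' p') (fibred_power_proj p') (power_map r f \<circ> power_map r g) id"
    \<comment> \<open>On points of the fibred power, which are extensional, \<open>power_map r id\<close> is the identity.\<close>
    by (rule fibrewise_homotopic_cong[OF fibrewise_homotopic_power_map[OF assms(1) fg]])
      (auto simp: power_map_def extensional_restrict
        dest: fibred_power_extensional intro!: restrict_ext)
qed

theorem proposition3p2:
  fixes B :: "'b topology"
    and E :: "'a topology" and p :: "'a \<Rightarrow> 'b"
    and E' :: "'c topology" and p' :: "'c \<Rightarrow> 'b"
    and r :: nat
  assumes "r \<ge> 2"
    and "fibrewise_space B E p"
    and "fibrewise_space B E' p'"
    and "fibrewise_homotopy_equivalent E p E' p'"
  shows "param_TC B r E p = param_TC B r E' p'"
proof -
  obtain f g where f: "fibrewise_map E p E' p' f" and g: "fibrewise_map E' p' E p g"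
    and gf: "fibrewise_homotopic E p E p (g \<circ> f) id"
    and fg: "fibrewise_homotopic E' p' E' p' (f \<circ> g) id"
    using assms(4) unfolding fibrewise_homotopy_equivalent_def by blast
  have "0 < r"
    using assms(1) by simp
  then show ?thesis
    using param_TC_le_of_dominated[OF _ f g fg] param_TC_le_of_dominated[OF _ g f gf]
    by (intro antisym)
qed

end
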